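(* Let $X$ be a real random variable and let $a \in \mathbb{R}$. (i) If $t > 0$ is such that $\operatorname{mgf}_X(t)$ is finite, and $U$ is a random variable independent of $X$ that is uniformly distributed over $[-1/t, 1/t]$, then $$\mathbb{P}(X + U \geq a) \leq \tfrac12 \operatorname{mgf}_X(t)\exp(-ta).$$ (ii) If $t < 0$ is such that $\operatorname{mgf}_X(t)$ is finite, and $U$ is a random variable independent of $X$ that is uniformly distributed over $[1/t, -1/t]$, then $$\mathbb{P}(X + U \leq a) \leq \tfrac12 \operatorname{mgf}_X(t)\exp(-ta).$$
   Context: The moment generating function of $X$ at $t$ is $\operatorname{mgf}_X(t) = \mathbb{E}[\exp(tX)]$. *)

theory Defs
  imports "HOL-Probability.Probability"
begin

text \<open>The Bochner integral is 0 for a non-integrable integrand. As the integrand is nonnegative,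
  finiteness of the moment generating function at \<open>t\<close> is integrability of \<open>exp (t X)\<close>.\<close>

definition mgf :: "'a measure \<Rightarrow> ('a \<Rightarrow> real) \<Rightarrow> real \<Rightarrow> real"
  where "mgf M X t = (\<integral>\<omega>. exp (t * X \<omega>) \<partial>M)"

definition mgf_finite :: "'a measure \<Rightarrow> ('a \<Rightarrow> real) \<Rightarrow> real \<Rightarrow> bool"
  where "mgf_finite M X t \<longleftrightarrow> integrable M (\<lambda>\<omega>. exp (t * X \<omega>))"

definition uniform_rv :: "'a measure \<Rightarrow> ('a \<Rightarrow> real) \<Rightarrow> real \<Rightarrow> real \<Rightarrow> bool"
  where "uniform_rv M U c d \<longleftrightarrow>
    distributed M lborel U (\<lambda>x. indicator {c..d} x / measure lborel {c..d})"

end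

theory Submission
  imports Defs
begin

text \<open>
  Take \<open>t > 0\<close>. Markov's inequality bounds the indicator of \<open>X \<ge> a\<close> by \<open>exp (t * (X - a))\<close>. Smoothing by \<open>U\<close>
  gains a factor of two: conditionally on \<open>X = x\<close>, the indicator of \<open>x + U \<ge> a\<close> averages to the
  uniform tail at \<open>s = a - x\<close>, which is at most the positive part of \<open>(1 - t * s) / 2\<close>, and
  \<open>1 - t * s \<le> exp (- t * s)\<close>. The half-width \<open>1 / t\<close> is the one for which the ramp \<open>(1 - t * s) / 2\<close>
  is tangent to \<open>exp (- t * s) / 2\<close>. Averaging over \<open>X\<close>, by independence and Fubini, gives
  \<open>exp (- t * a) * mgf M X t / 2\<close>.

  The argument is carried out for lower tails, where the tail of \<open>U\<close> is its distribution function: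
  \<open>uniform_rv_lower_tail\<close> is the tangent-line estimate and \<open>indep_sum_lower_tail\<close> the averaging. Upper tails follow by reflecting \<open>X\<close>, \<open>U\<close>, \<open>t\<close> and
  \<open>a\<close> through the origin, which preserves a symmetric uniform law.
\<close>

lemma (in prob_space) uniform_rv_uminus:
  assumes "uniform_rv M U (- r) r"
  shows "uniform_rv M (\<lambda>\<omega>. - U \<omega>) (- r) r"
proof -
  have "indicator {- r..r} (- x) = (indicator {- r..r} x :: real)" for x
    by (auto split: split_indicator)
  with distributed_affine[OF assms[unfolded uniform_rv_def], of "- 1" 0] show ?thesis
    by (simp add: uniform_rv_def divide_ennreal_def del: content_real_if)
qed

text \<open>On \<open>[- r, r]\<close> the distribution function is the line \<open>(1 + s / r) / 2\<close>, half the tangent of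
  \<open>exp (s / r)\<close> at \<open>0\<close>. To the left it vanishes, and to the right the line already exceeds \<open>1\<close>.\<close>

lemma (in prob_space) uniform_rv_lower_tail:
  assumes U: "uniform_rv M U (- r) r"
  shows "\<P>(\<omega> in M. U \<omega> \<le> s) \<le> 1 / 2 * exp (s / r)"
proof -
  note D = U[unfolded uniform_rv_def]
  have r: "r > 0"
    using uniform_distributed_bounds[OF D] by simp
  have [measurable]: "U \<in> borel_measurable M"
    using distributed_measurable[OF D] by simp
  have tangent: "(1 + s / r) / 2 \<le> 1 / 2 * exp (s / r)"
    using divide_right_mono[OF exp_ge_add_one_self[of "s / r"], of 2] by simp
  consider "s < - r" | "- r \<le> s" "s \<le> r" | "r < s"
    by linarith
  then show ?thesis
  proof cases
    case 1
    then have "\<P>(\<omega> in M. U \<omega> \<le> s) \<le> \<P>(\<omega> in M. U \<omega> \<le> - r)"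
      by (intro finite_measure_mono) auto
    also have "\<dots> = 0"
      using uniform_distributed_measure[OF D, of "- r"] r by simp
    finally show ?thesis
      by (rule order_trans) simp
  next
    case 2
    then have "\<P>(\<omega> in M. U \<omega> \<le> s) = (1 + s / r) / 2"
      using uniform_distributed_measure[OF D 2] r by (simp add: field_simps)
    with tangent show ?thesis by simp
  next
    case 3
    then have "1 \<le> (1 + s / r) / 2"
      using r by (simp add: field_simps)
    with tangent prob_le_1[of "{\<omega> \<in> space M. U \<omega> \<le> s}"] show ?thesis
      by linarith
  qed
qed

text \<open>Conditionally on \<open>X = x\<close> the event is \<open>U \<le> a - x\<close>, so an exponential bound on the tail of \<open>U\<close>
  turns into a multiple of \<open>exp (t * x)\<close>, whose average is the moment generating function of \<open>X\<close>.\<close>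

lemma (in prob_space) indep_sum_lower_tail:
  fixes X U :: "'a \<Rightarrow> real"
  assumes indep: "indep_var borel X borel U"
    and mgf: "mgf_finite M X t"
    and tail: "\<And>s. \<P>(\<omega> in M. U \<omega> \<le> s) \<le> C * exp (- t * s)"
  shows "\<P>(\<omega> in M. X \<omega> + U \<omega> \<le> a) \<le> C * mgf M X t * exp (- t * a)"
proof -
  have [measurable]: "X \<in> borel_measurable M" "U \<in> borel_measurable M"
    using indep_var_rv1[OF indep] indep_var_rv2[OF indep] by auto
  have C: "0 \<le> C"
    using order_trans[OF measure_nonneg tail[of 0]] by simp
  let ?X = "distr M borel X" and ?U = "distr M borel U"
  let ?A = "{p :: real \<times> real. fst p + snd p \<le> a}"
  interpret U: prob_space ?U by (rule prob_space_distr) simp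
  have "{p \<in> space (borel \<Otimes>\<^sub>M borel). fst p + snd p \<le> a} \<in> sets (borel \<Otimes>\<^sub>M borel)"
    by measurable
  then have A: "?A \<in> sets (borel \<Otimes>\<^sub>M borel)"
    by (simp add: space_pair_measure)
  have section_A: "emeasure ?U (Pair x -` ?A) \<le> ennreal (C * exp (- t * a) * exp (t * x))" for x
  proof -
    have "emeasure ?U (Pair x -` ?A) = emeasure ?U {..a - x}"
      by (intro arg_cong2[where f = emeasure]) (auto simp: algebra_simps)
    also have "\<dots> = \<P>(\<omega> in M. U \<omega> \<le> a - x)"
      by (subst emeasure_distr)
        (auto simp: emeasure_eq_measure intro!: arg_cong[where f = prob])
    also have "\<dots> \<le> ennreal (C * exp (- t * (a - x)))"
      by (intro ennreal_leI tail)
    also have "C * exp (- t * (a - x)) = C * exp (- t * a) * exp (t * x)"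
      by (simp add: exp_add[symmetric] algebra_simps)
    finally show ?thesis .
  qed
  have "ennreal (\<P>(\<omega> in M. X \<omega> + U \<omega> \<le> a)) =
      emeasure (distr M (borel \<Otimes>\<^sub>M borel) (\<lambda>\<omega>. (X \<omega>, U \<omega>))) ?A"
    using A by (subst emeasure_distr)
      (auto simp: emeasure_eq_measure intro!: arg_cong[where f = prob])
  also have "\<dots> = emeasure (?X \<Otimes>\<^sub>M ?U) ?A"
    using indep by (simp add: indep_var_distribution_eq)
  also have "\<dots> = (\<integral>\<^sup>+x. emeasure ?U (Pair x -` ?A) \<partial>?X)"
    using A by (intro U.emeasure_pair_measure_alt) (simp cong: sets_pair_measure_cong)
  also have "\<dots> \<le> (\<integral>\<^sup>+x. ennreal (C * exp (- t * a) * exp (t * x)) \<partial>?X)"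
    by (intro nn_integral_mono section_A)
  also have "\<dots> = (\<integral>\<^sup>+\<omega>. ennreal (C * exp (- t * a) * exp (t * X \<omega>)) \<partial>M)"
    by (simp add: nn_integral_distr)
  also have "\<dots> = ennreal (\<integral>\<omega>. C * exp (- t * a) * exp (t * X \<omega>) \<partial>M)"
    using mgf C by (intro nn_integral_eq_integral) (auto simp: mgf_finite_def)
  also have "(\<integral>\<omega>. C * exp (- t * a) * exp (t * X \<omega>) \<partial>M) = C * mgf M X t * exp (- t * a)"
    by (simp add: mgf_def)
  finally show ?thesis
    using C by (simp add: ennreal_le_iff mgf_def)
qed

lemma (in prob_space) indep_sum_uniform_lower_tail:
  assumes "indep_var borel X borel U" "mgf_finite M X t" "uniform_rv M U (1 / t) (- (1 / t))"
  shows "\<P>(\<omega> in M. X \<omega> + U \<omega> \<le> a) \<le> 1 / 2 * mgf M X t * exp (- t * a)"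
proof (rule indep_sum_lower_tail[OF assms(1,2)])
  show "\<P>(\<omega> in M. U \<omega> \<le> s) \<le> 1 / 2 * exp (- t * s)" for s
    using uniform_rv_lower_tail[of U "- (1 / t)" s] assms(3) by (simp add: mult.commute)
qed

lemma (in prob_space) indep_sum_uniform_upper_tail:
  assumes indep: "indep_var borel X borel U" and mgf: "mgf_finite M X t"
    and U: "uniform_rv M U (- (1 / t)) (1 / t)"
  shows "\<P>(\<omega> in M. X \<omega> + U \<omega> \<ge> a) \<le> 1 / 2 * mgf M X t * exp (- t * a)"
proof -
  have "indep_var borel (\<lambda>\<omega>. - X \<omega>) borel (\<lambda>\<omega>. - U \<omega>)"
    using indep_var_compose[OF indep, of uminus borel uminus borel] by (simp add: comp_def)
  moreover have "mgf_finite M (\<lambda>\<omega>. - X \<omega>) (- t)"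
    using mgf by (simp add: mgf_finite_def)
  moreover have "uniform_rv M (\<lambda>\<omega>. - U \<omega>) (1 / (- t)) (- (1 / (- t)))"
    using uniform_rv_uminus[OF U] by simp
  ultimately have "\<P>(\<omega> in M. - X \<omega> + - U \<omega> \<le> - a) \<le>
      1 / 2 * mgf M (\<lambda>\<omega>. - X \<omega>) (- t) * exp (- (- t) * (- a))"
    by (rule indep_sum_uniform_lower_tail)
  moreover have "- X \<omega> + - U \<omega> \<le> - a \<longleftrightarrow> X \<omega> + U \<omega> \<ge> a" for \<omega>
    by linarith
  ultimately show ?thesis
    by (simp add: mgf_def)
qed

theorem lemma13:
  fixes M :: "'a measure" and X :: "'a \<Rightarrow> real" and a :: real
  assumes "prob_space M"
    and "X \<in> borel_measurable M"
  shows "(\<forall>(t::real) (U::'a \<Rightarrow> real).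
            t > 0 \<longrightarrow> mgf_finite M X t \<longrightarrow>
            prob_space.indep_var M borel X borel U \<longrightarrow> uniform_rv M U (- (1 / t)) (1 / t) \<longrightarrow>
            \<P>(\<omega> in M. X \<omega> + U \<omega> \<ge> a) \<le> 1 / 2 * mgf M X t * exp (- t * a))
       \<and> (\<forall>(t::real) (U::'a \<Rightarrow> real).
            t < 0 \<longrightarrow> mgf_finite M X t \<longrightarrow>
            prob_space.indep_var M borel X borel U \<longrightarrow> uniform_rv M U (1 / t) (- (1 / t)) \<longrightarrow>
            \<P>(\<omega> in M. X \<omega> + U \<omega> \<le> a) \<le> 1 / 2 * mgf M X t * exp (- t * a))"
proof -
  interpret prob_space M by fact
  show ?thesis
    using indep_sum_uniform_upper_tail indep_sum_uniform_lower_tail by blast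
qed

end
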